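(* For every graph $G$, $f(G,1)\ge h(G,K_3)$. Moreover, if $G$ is perfect, then $f(G,1)=h(G,K_3)$.
   Context: $f(G,1)$ is the minimum, over all orientations of $G$, of the number of vertices having both indegree at least $1$ and outdegree at least $1$. $h(G,K_3)$ is the minimum cardinality of a set $T\subseteq V(G)$ such that every triangle of $G$ contains a vertex of $T$. A graph is perfect if every induced subgraph $G^*$ (including $G$) satisfies $\chi(G^* )=\omega(G^* )$. *)

theory Defs
  imports "Graph_Theory.Graph_Theory"
begin

text \<open>
  Finite simple graphs are represented as in \<^theory>\<open>Graph_Theory.Pair_Digraph\<close>: the locale
  \<^locale>\<open>pair_graph\<close> describes finite, loop-free, symmetric relations, where an edge between
  \<open>u\<close> and \<open>v\<close> is stored as the two arcs \<open>(u, v)\<close> and \<open>(v, u)\<close>.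
\<close>

text \<open>The graph underlying \<open>D\<close> is \<open>G\<close>, and no edge of \<open>G\<close> is used in both directions.\<close>

definition orientation :: "'a pair_pre_digraph \<Rightarrow> 'a pair_pre_digraph \<Rightarrow> bool" where
  "orientation D G \<longleftrightarrow> mk_symmetric (with_proj D) = G \<and> asym (parcs D)"

definition mixed_verts :: "'a pair_pre_digraph \<Rightarrow> nat \<Rightarrow> 'a set" where
  "mixed_verts D k =
     {v \<in> pverts D. in_degree (with_proj D) v \<ge> k \<and> out_degree (with_proj D) v \<ge> k}"

text \<open>
  The number \<open>f(G, k)\<close>. On \<^typ>\<open>nat\<close> the infimum of a nonempty set is its minimum; that orientations
  exist is shown in \<open>ex_orientation\<close> below.
\<close>

definition f_orient :: "'a pair_pre_digraph \<Rightarrow> nat \<Rightarrow> nat" where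
  "f_orient G k = (INF D \<in> {D. orientation D G}. card (mixed_verts D k))"

definition triangle_of :: "'a pair_pre_digraph \<Rightarrow> 'a pair_pre_digraph \<Rightarrow> bool" where
  "triangle_of H G \<longleftrightarrow> subgraph (with_proj H) (with_proj G) \<and> complete_digraph 3 (with_proj H)"

definition triangle_transversal :: "'a pair_pre_digraph \<Rightarrow> 'a set \<Rightarrow> bool" where
  "triangle_transversal G T \<longleftrightarrow>
     T \<subseteq> pverts G \<and> (\<forall>H. triangle_of H G \<longrightarrow> T \<inter> pverts H \<noteq> {})"

text \<open>The number \<open>h(G, K\<^sub>3)\<close>; the set of all vertices is always a transversal.\<close>

definition h_K3 :: "'a pair_pre_digraph \<Rightarrow> nat" where
  "h_K3 G = (INF T \<in> {T. triangle_transversal G T}. card T)"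

definition proper_coloring :: "'a pair_pre_digraph \<Rightarrow> nat \<Rightarrow> ('a \<Rightarrow> nat) \<Rightarrow> bool" where
  "proper_coloring G n c \<longleftrightarrow>
     (\<forall>v \<in> pverts G. c v < n) \<and> (\<forall>(u, v) \<in> parcs G. c u \<noteq> c v)"

definition chromatic_number :: "'a pair_pre_digraph \<Rightarrow> nat" where
  "chromatic_number G = (LEAST n. \<exists>c. proper_coloring G n c)"

definition clique_number :: "'a pair_pre_digraph \<Rightarrow> nat" where
  "clique_number G =
     Max {n. \<exists>H :: 'a pair_pre_digraph.
               subgraph (with_proj H) (with_proj G) \<and> complete_digraph n (with_proj H)}"

definition perfect :: "'a pair_pre_digraph \<Rightarrow> bool" where
  "perfect G \<longleftrightarrow>
     (\<forall>H :: 'a pair_pre_digraph. induced_subgraph (with_proj H) (with_proj G) \<longrightarrow>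
        chromatic_number H = clique_number H)"

lemma ex_orientation:
  assumes "pair_graph G"
  shows "\<exists>D. orientation D G"
proof -
  interpret pair_graph G by fact
  obtain r :: "'a \<Rightarrow> nat" where r: "inj_on r (pverts G)"
    using finite_imp_inj_to_nat_seg[OF pair_finite_verts] by blast
  define D where "D = \<lparr>pverts = pverts G, parcs = {(u, v) \<in> parcs G. r u < r v}\<rparr>"
  have s: "(v, u) \<in> parcs G" if "(u, v) \<in> parcs G" for u v
    using pair_sym_arcs that by (auto simp: symmetric_def dest: symD)
  have "r u < r v \<or> r v < r u" if "(u, v) \<in> parcs G" for u v
    using that r no_loops'[OF that] wellformed'[OF that] by (metis inj_onD linorder_neqE_nat)
  then have "(\<Union>e\<in>parcs D. {(fst e, snd e), (snd e, fst e)}) = parcs G"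
    using s by (fastforce simp: D_def)
  then have "mk_symmetric (with_proj D) = G"
    by (simp add: mk_symmetric_def D_def)
  moreover have "asym (parcs D)"
    by (rule asymI) (auto simp: D_def)
  ultimately show ?thesis
    unfolding orientation_def by blast
qed

lemma triangle_transversal_verts: "triangle_transversal G (pverts G)"
proof -
  have "pverts H \<subseteq> pverts G" "card (pverts H) = 3" if "triangle_of H G" for H
    using that by (auto simp: triangle_of_def subgraph_def complete_digraph_def)
  then show ?thesis
    unfolding triangle_transversal_def by (metis card.empty inf.absorb2 order_refl zero_neq_numeral)
qed

end

theory Submission
  imports Defs
begin

text \<open>
  In an orientation of a triangle some vertex has both an incoming and an outgoing arc, since
  otherwise each vertex would be a source or a sink and the triangle would be bipartite. Hence the
  mixed vertices of any orientation meet all triangles. Conversely, if \<open>T\<close> meets all triangles of a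
  perfect graph, then deleting \<open>T\<close> leaves a graph of clique number at most 2, which is therefore
  bipartite. Put one colour class below \<open>T\<close> and the other above it, and orient every edge upwards:
  the classes then consist of sources and sinks, so that only vertices of \<open>T\<close> can be mixed.
\<close>

lemma orientation_pverts: "orientation D G \<Longrightarrow> pverts D = pverts G"
  by (auto simp: orientation_def mk_symmetric_def)

lemma orientation_parcs_iff:
  assumes "orientation D G"
  shows "(u, v) \<in> parcs G \<longleftrightarrow> (u, v) \<in> parcs D \<or> (v, u) \<in> parcs D"
proof -
  have "parcs G = (\<Union>e\<in>parcs D. {(fst e, snd e), (snd e, fst e)})"
    using assms parcs_mk_symmetric[of "with_proj D"] by (simp add: orientation_def)
  then show ?thesis by (fastforce simp del: prod.collapse)
qed

text \<open>Every edge rises along \<open>r\<close> in exactly one direction, and symmetry of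
  \<open>G\<close> recovers the reverse arc. Only the ends of an edge need distinct values, so a
  whole colour class may share one level.\<close>

lemma orientation_increasing:
  fixes r :: "'a \<Rightarrow> nat"
  assumes "pair_graph G" and r: "\<And>u v. (u, v) \<in> parcs G \<Longrightarrow> r u \<noteq> r v"
  shows "orientation \<lparr>pverts = pverts G, parcs = {(u, v) \<in> parcs G. r u < r v}\<rparr> G"
    (is "orientation ?D G")
proof -
  interpret pair_graph G by fact
  have "(\<Union>e\<in>parcs ?D. {(fst e, snd e), (snd e, fst e)}) = parcs G"
    using arcs_symmetric r by (fastforce simp: neq_iff)
  then have "mk_symmetric (with_proj ?D) = G"
    by (simp add: mk_symmetric_def)
  moreover have "asym (parcs ?D)"
    by (rule asymI) auto
  ultimately show ?thesis
    by (simp add: orientation_def)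
qed

text \<open>Degrees are cardinalities, and an infinite set has cardinality 0; finiteness is what
  makes degree at least 1 equivalent to the existence of an arc.\<close>

lemma mixed_verts_1:
  assumes "finite (parcs D)"
  shows "mixed_verts D 1 = {v \<in> pverts D. (\<exists>u. (u, v) \<in> parcs D) \<and> (\<exists>w. (v, w) \<in> parcs D)}"
proof -
  have "finite (in_arcs (with_proj D) v)" "finite (out_arcs (with_proj D) v)" for v
    using assms by (auto simp: in_arcs_def out_arcs_def)
  then have "in_degree (with_proj D) v \<ge> 1 \<longleftrightarrow> (\<exists>u. (u, v) \<in> parcs D)"
    and "out_degree (with_proj D) v \<ge> 1 \<longleftrightarrow> (\<exists>w. (v, w) \<in> parcs D)" for v
    by (auto simp: in_degree_def out_degree_def Suc_le_eq card_gt_0_iff in_arcs_def out_arcs_def)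
  then show ?thesis
    by (simp add: mixed_verts_def)
qed

lemma triangle_transversal_mixed_verts:
  assumes "pair_graph G" and D: "orientation D G"
  shows "triangle_transversal G (mixed_verts D 1)"
proof -
  interpret pair_graph G by fact
  note arcs = orientation_parcs_iff[OF D] and verts = orientation_pverts[OF D]
  have "parcs D \<subseteq> parcs G"
    using arcs by auto
  then have "finite (parcs D)"
    using pair_finite_arcs finite_subset by blast
  note mixed = mixed_verts_1[OF this]
  have "mixed_verts D 1 \<inter> pverts H \<noteq> {}" if H: "triangle_of H G" for H
  proof -
    from H have sub: "pverts H \<subseteq> pverts G" "parcs H \<subseteq> parcs G"
      and "card (pverts H) = 3" and arcs_H: "parcs H = {(u, v) \<in> pverts H \<times> pverts H. u \<noteq> v}"
      by (auto simp: triangle_of_def subgraph_def complete_digraph_pair_def)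
    then obtain x y z where H': "pverts H = {x, y, z}" "x \<noteq> y" "x \<noteq> z" "y \<noteq> z"
      by (auto simp: card_3_iff)
    then have "(x, y) \<in> parcs H" "(y, z) \<in> parcs H" "(x, z) \<in> parcs H"
      by (simp_all add: arcs_H)
    then have "(x, y) \<in> parcs G" "(y, z) \<in> parcs G" "(x, z) \<in> parcs G"
      using sub(2) by blast+
    \<comment> \<open>\<open>arcs\<close> splits each edge into its two possible directions in
      \<open>D\<close>. If the triangle is cyclic, all three vertices are mixed; otherwise it is
      transitive and its middle vertex is mixed.\<close>
    then have "x \<in> mixed_verts D 1 \<or> y \<in> mixed_verts D 1 \<or> z \<in> mixed_verts D 1"
      unfolding arcs mixed verts using H'(1) sub(1) by blast
    then show ?thesis
      using H'(1) by blast
  qed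
  then show ?thesis
    using verts by (auto simp: triangle_transversal_def mixed_verts_def)
qed

text \<open>Any three vertices of a clique span a triangle, so no clique can have more than
  two.\<close>

lemma clique_number_le_2:
  fixes H :: "'a pair_pre_digraph"
  assumes "pair_wf_digraph H" and no_triangle: "\<And>K. \<not> triangle_of K H"
  shows "clique_number H \<le> 2"
proof -
  define S where "S = {n. \<exists>K :: 'a pair_pre_digraph.
    subgraph (with_proj K) (with_proj H) \<and> complete_digraph n (with_proj K)}"
  have wf: "wf_digraph (with_proj H)"
    using assms(1) by (simp add: wf_digraph_wp_iff)
  have "n \<le> 2" if "n \<in> S" for n
  proof (rule ccontr)
    assume "\<not> n \<le> 2"
    moreover from that obtain K :: "'a pair_pre_digraph" where K: "pverts K \<subseteq> pverts H"
      "parcs K \<subseteq> parcs H" "card (pverts K) = n"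
      "parcs K = {(u, v). (u, v) \<in> pverts K \<times> pverts K \<and> u \<noteq> v}"
      by (auto simp: S_def subgraph_def complete_digraph_pair_def)
    ultimately obtain A where A: "A \<subseteq> pverts K" "card A = 3"
      by (metis not_less_eq_eq numeral_2_eq_2 numeral_3_eq_3 obtain_subset_with_card_n)
    define L where "L = \<lparr>pverts = A, parcs = {(u, v). (u, v) \<in> A \<times> A \<and> u \<noteq> v}\<rparr>"
    have "finite A"
      using A(2) card.infinite by fastforce
    then have complete: "complete_digraph 3 (with_proj L)"
      by (simp add: complete_digraph_pair_def L_def A)
    then have "wf_digraph (with_proj L)"
      using pair_graph.axioms(1) pair_graphI_complete
      by (metis pair_digraph.pair_wf_digraph wf_digraph_wp_iff)
    moreover have "pverts L \<subseteq> pverts H" "parcs L \<subseteq> parcs H"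
      using A K by (auto simp: L_def)
    ultimately have "triangle_of L H"
      using wf complete by (auto simp: triangle_of_def intro!: subgraphI)
    with no_triangle show False by blast
  qed
  \<comment> \<open>\<open>Max\<close> can be bounded through its elements only on a finite nonempty
    set. The empty graph, complete on 0 vertices, gives nonemptiness; the bound just shown gives
    finiteness.\<close>
  moreover have "0 \<in> S"
  proof -
    define E :: "'a pair_pre_digraph" where "E = \<lparr>pverts = {}, parcs = {}\<rparr>"
    have "wf_digraph (with_proj E)"
      by unfold_locales (auto simp: E_def)
    then have "subgraph (with_proj E) (with_proj H)"
      using wf by (intro subgraphI) (auto simp: E_def)
    moreover have "complete_digraph 0 (with_proj E)"
      by (auto simp: complete_digraph_pair_def E_def)
    ultimately show ?thesis
      unfolding S_def by blast
  qed
  moreover have "finite S"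
    using calculation(1) by (meson finite_nat_set_iff_bounded_le)
  ultimately show ?thesis
    unfolding clique_number_def S_def[symmetric] by (subst Max_le_iff) auto
qed

text \<open>The \<open>LEAST\<close> in \<open>chromatic_number\<close> is attained once some proper
  colouring exists; an injective numbering of the vertices is one.\<close>

lemma ex_proper_coloring_chromatic_number:
  assumes "pair_digraph H"
  shows "\<exists>c. proper_coloring H (chromatic_number H) c"
proof -
  interpret pair_digraph H by fact
  obtain f :: "'a \<Rightarrow> nat" and n where f: "f ` pverts H = {i. i < n}" "inj_on f (pverts H)"
    using finite_imp_inj_to_nat_seg[OF pair_finite_verts] by blast
  have "proper_coloring H n f"
    unfolding proper_coloring_def
  proof (intro conjI ballI; clarify?)
    show "f v < n" if "v \<in> pverts H" for v
      using f(1) that by blast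
    show False if "(u, v) \<in> parcs H" "f u = f v" for u v
      using that f(2) no_loops' wellformed' by (metis inj_onD)
  qed
  then show ?thesis
    unfolding chromatic_number_def by (intro LeastI[where P = "\<lambda>n. \<exists>c. proper_coloring H n c"]) blast
qed

lemma perfect_ex_mixed_verts_subset:
  fixes G :: "'a pair_pre_digraph"
  assumes "pair_graph G" "perfect G" and T: "triangle_transversal G T"
  shows "\<exists>D. orientation D G \<and> mixed_verts D 1 \<subseteq> T"
proof -
  interpret pair_graph G by fact
  \<comment> \<open>The induced subgraph left after deleting \<open>T\<close>. It has no triangle,
    and perfection of \<open>G\<close> turns the bound on its clique number into one on its
    chromatic number.\<close>
  define H where "H = \<lparr>pverts = pverts G - T,
    parcs = {(u, v) \<in> parcs G. u \<notin> T \<and> v \<notin> T}\<rparr>"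
  have arcs_H: "parcs H = {e \<in> parcs G. fst e \<in> pverts H \<and> snd e \<in> pverts H}"
    using wellformed' by (auto simp: H_def)
  have "finite (parcs H)"
    by (rule finite_subset[OF _ pair_finite_arcs]) (auto simp: H_def)
  then have H: "pair_digraph H"
    using wellformed' pair_finite_verts no_loops' by unfold_locales (auto simp: H_def)
  then have wf_H: "pair_wf_digraph H"
    by (rule pair_digraph.pair_wf_digraph)
  have sub: "subgraph (with_proj H) (with_proj G)"
    using wf_H wf_digraph_axioms by (intro subgraphI) (auto simp: H_def wf_digraph_wp_iff)
  have "\<not> triangle_of K H" for K
  proof
    assume K: "triangle_of K H"
    then have "triangle_of K G"
      using sub subgraph_trans by (auto simp: triangle_of_def)
    moreover have "T \<inter> pverts K = {}"
      using K by (auto simp: triangle_of_def subgraph_def H_def)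
    ultimately show False
      using T by (auto simp: triangle_transversal_def)
  qed
  then have "clique_number H \<le> 2"
    using wf_H by (intro clique_number_le_2)
  moreover have "induced_subgraph (with_proj H) (with_proj G)"
    using sub arcs_H by (intro induced_subgraphI) auto
  ultimately have "chromatic_number H \<le> 2"
    using \<open>perfect G\<close> by (simp add: perfect_def)
  moreover obtain c where coloring: "proper_coloring H (chromatic_number H) c"
    using ex_proper_coloring_chromatic_number[OF H] by blast
  ultimately have c: "c v = 0 \<or> c v = 1" if "v \<in> pverts G" "v \<notin> T" for v
    using that by (force simp: proper_coloring_def H_def)
  have proper: "c u \<noteq> c v" if "(u, v) \<in> parcs G" "u \<notin> T" "v \<notin> T" for u v
    using coloring that by (auto simp: proper_coloring_def H_def)
  obtain f :: "'a \<Rightarrow> nat" and n where f: "f ` pverts G = {i. i < n}" "inj_on f (pverts G)"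
    using finite_imp_inj_to_nat_seg[OF pair_finite_verts] by blast
  have f_less: "f v < n" if "v \<in> pverts G" for v
    using f(1) that by blast
  \<comment> \<open>Colour 0 lies at level 0 and the other colour at level \<open>Suc n\<close>.
    Since \<open>f\<close> is injective with values below \<open>n\<close>, the vertices of
    \<open>T\<close> get distinct levels from 1 to \<open>n\<close>, strictly between the
    classes.\<close>
  define r where "r v = (if v \<in> T then Suc (f v) else if c v = 0 then 0 else Suc n)" for v
  define D where "D = \<lparr>pverts = pverts G, parcs = {(u, v) \<in> parcs G. r u < r v}\<rparr>"
  have "r u \<noteq> r v" if "(u, v) \<in> parcs G" for u v
  proof -
    have uv: "u \<in> pverts G" "v \<in> pverts G" "u \<noteq> v"
      using that wellformed' no_loops' by auto
    then have "f u \<noteq> f v"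
      using f(2) by (auto dest: inj_onD)
    then show ?thesis
      using uv c[of u] c[of v] proper[OF that] f_less[of u] f_less[of v]
      by (cases "u \<in> T"; cases "v \<in> T") (auto simp: r_def)
  qed
  then have "orientation D G"
    unfolding D_def by (rule orientation_increasing[OF \<open>pair_graph G\<close>])
  moreover have "mixed_verts D 1 \<subseteq> T"
  proof
    fix v assume v: "v \<in> mixed_verts D 1"
    have "finite (parcs D)"
      by (rule finite_subset[OF _ pair_finite_arcs]) (auto simp: D_def)
    from v obtain u w where "(v, w) \<in> parcs G" "r u < r v" "r v < r w"
      unfolding mixed_verts_1[OF \<open>finite (parcs D)\<close>] by (auto simp: D_def)
    \<comment> \<open>Outside \<open>T\<close> the level of \<open>v\<close> is 0 or
      \<open>Suc n\<close>. The first contradicts \<open>r u < r v\<close>, the second contradicts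
      \<open>r v < r w\<close> together with this upper bound.\<close>
    moreover from this have "r w \<le> Suc n"
      using f_less[of w] wellformed' by (auto simp: r_def)
    ultimately show "v \<in> T"
      by (auto simp: r_def split: if_splits)
  qed
  ultimately show ?thesis by blast
qed

theorem theorem8:
  fixes G :: "'a pair_pre_digraph"
  assumes "pair_graph G"
  shows "f_orient G 1 \<ge> h_K3 G \<and> (perfect G \<longrightarrow> f_orient G 1 = h_K3 G)"
proof -
  interpret pair_graph G by fact
  have ge: "h_K3 G \<le> f_orient G 1"
    unfolding f_orient_def
  proof (rule cINF_greatest)
    \<comment> \<open>An infimum can be bounded below by bounding its terms only when the index set
      is nonempty. Each term is then handled by using its mixed vertices as a candidate in the
      infimum \<open>h_K3 G\<close>.\<close>
    show "{D. orientation D G} \<noteq> {}"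
      using ex_orientation[OF assms] by blast
    show "h_K3 G \<le> card (mixed_verts D 1)" if "D \<in> {D. orientation D G}" for D
      unfolding h_K3_def
      using that triangle_transversal_mixed_verts[OF assms] by (intro cINF_lower) auto
  qed
  moreover have "f_orient G 1 \<le> h_K3 G" if perfect: "perfect G"
    unfolding h_K3_def
  proof (rule cINF_greatest)
    show "{T. triangle_transversal G T} \<noteq> {}"
      using triangle_transversal_verts by blast
    fix T assume "T \<in> {T. triangle_transversal G T}"
    then have T: "triangle_transversal G T" by simp
    then obtain D where D: "orientation D G" "mixed_verts D 1 \<subseteq> T"
      using perfect_ex_mixed_verts_subset[OF assms perfect] by blast
    have "finite T"
      using T pair_finite_verts by (auto simp: triangle_transversal_def intro: finite_subset)
    have "f_orient G 1 \<le> card (mixed_verts D 1)"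
      unfolding f_orient_def using D by (intro cINF_lower) auto
    also have "\<dots> \<le> card T"
      using D \<open>finite T\<close> by (intro card_mono)
    finally show "f_orient G 1 \<le> card T" .
  qed
  ultimately show ?thesis
    by auto
qed

end
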